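(* If $G$ is a nontrivial compact group, then for any $1\le p<+\infty$, any $S\subset G$, any $\Gamma\subset\mathbb{C}$ and any $S$-admissible weight $\omega$ on $G$, the space $L^p(G,\omega)$ has no $(\Gamma,S)$-dense vectors.
   Context: Let $\mu$ be a left Haar measure on $G$. A weight on $G$ is a positive measurable function $\omega:G\to(0,+\infty)$ that is locally $p$-integrable, i.e. $\int_K\omega^p\,d\mu<+\infty$ for every compact $K\subset G$. $L^p(G,\omega)$ is the space of measurable $f:G\to\mathbb{C}$ (modulo a.e. equality) with $\|f\|_{p,\omega}:=\left(\int_G|f(t)|^p\omega(t)^p\,d\mu(t)\right)^{1/p}<\infty$, with this norm. For $s\in G$, the left translation is $(T_sf)(t)=f(s^{-1}t)$. The weight $\omega$ is $S$-admissible if $M(s):=\operatorname{ess\,sup}_{t\in G}\omega(st)/\omega(t)<+\infty$ for all $s\in S$ (equivalently, $T_s$ is a bounded operator of $L^p(G,\omega)$ into itself for every $s\in S$). A vector $f\in L^p(G,\omega)$ is $(\Gamma,S)$-dense if $\{\lambda T_sf:\ \lambda\in\Gamma,\ s\in S\}$ is dense in $L^p(G,\omega)$. *)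

theory Defs
  imports "HOL-Analysis.Analysis" "HOL-Probability.Essential_Supremum"
begin

text \<open>
  Groups are types of class \<^class>\<open>topological_group_add\<close>, which does not assume commutativity;
  the multiplicative notation $st$, $s^{-1}t$ of the literature thus reads \<open>s + t\<close>, \<open>- s + t\<close>.
  Topological groups are Hausdorff.
\<close>

text \<open>
  A nonzero left-invariant Radon measure on the Borel sets. The regularity conditions are
  not redundant, since the group need not be second countable.
\<close>
definition left_haar_measure :: "'a::{topological_group_add, t2_space} measure \<Rightarrow> bool" where
  "left_haar_measure \<mu> \<longleftrightarrow>
     sets \<mu> = sets borel \<and>
     emeasure \<mu> UNIV \<noteq> 0 \<and>
     (\<forall>K. compact K \<longrightarrow> emeasure \<mu> K < \<infinity>) \<and>
     (\<forall>s. \<forall>A\<in>sets borel. emeasure \<mu> ((\<lambda>t. s + t) ` A) = emeasure \<mu> A) \<and>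
     (\<forall>A\<in>sets borel. emeasure \<mu> A = (INF U\<in>{U. open U \<and> A \<subseteq> U}. emeasure \<mu> U)) \<and>
     (\<forall>U. open U \<longrightarrow> emeasure \<mu> U = (SUP K\<in>{K. compact K \<and> K \<subseteq> U}. emeasure \<mu> K))"

definition weight :: "'a::topological_space measure \<Rightarrow> real \<Rightarrow> ('a \<Rightarrow> real) \<Rightarrow> bool" where
  "weight \<mu> p \<omega> \<longleftrightarrow>
     \<omega> \<in> borel_measurable \<mu> \<and>
     (\<forall>t. 0 < \<omega> t) \<and>
     (\<forall>K. compact K \<longrightarrow> (\<integral>\<^sup>+t\<in>K. ennreal (\<omega> t powr p) \<partial>\<mu>) < \<infinity>)"

definition admissible :: "'a::plus measure \<Rightarrow> 'a set \<Rightarrow> ('a \<Rightarrow> real) \<Rightarrow> bool" where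
  "admissible \<mu> S \<omega> \<longleftrightarrow> (\<forall>s\<in>S. esssup \<mu> (\<lambda>t. ereal (\<omega> (s + t) / \<omega> t)) < \<infinity>)"

text \<open>
  Elements of $L^p(G,\omega)$ are represented by functions; functions that agree almost
  everywhere are at distance $0$ for \<open>Lp_norm\<close>, so density may be tested on representatives.
\<close>
definition Lp_space :: "'a measure \<Rightarrow> real \<Rightarrow> ('a \<Rightarrow> real) \<Rightarrow> ('a \<Rightarrow> complex) set" where
  "Lp_space \<mu> p \<omega> =
     {f \<in> borel_measurable \<mu>. integrable \<mu> (\<lambda>t. cmod (f t) powr p * \<omega> t powr p)}"

definition Lp_norm :: "'a measure \<Rightarrow> real \<Rightarrow> ('a \<Rightarrow> real) \<Rightarrow> ('a \<Rightarrow> complex) \<Rightarrow> real" where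
  "Lp_norm \<mu> p \<omega> f = (\<integral>t. cmod (f t) powr p * \<omega> t powr p \<partial>\<mu>) powr (1 / p)"

definition Lp_dense :: "'a measure \<Rightarrow> real \<Rightarrow> ('a \<Rightarrow> real) \<Rightarrow> ('a \<Rightarrow> complex) set \<Rightarrow> bool" where
  "Lp_dense \<mu> p \<omega> A \<longleftrightarrow>
     A \<subseteq> Lp_space \<mu> p \<omega> \<and>
     (\<forall>g\<in>Lp_space \<mu> p \<omega>. \<forall>\<epsilon>>0. \<exists>h\<in>A. Lp_norm \<mu> p \<omega> (\<lambda>t. g t - h t) < \<epsilon>)"

definition left_translation :: "'a::group_add \<Rightarrow> ('a \<Rightarrow> 'b) \<Rightarrow> 'a \<Rightarrow> 'b" where
  "left_translation s f = (\<lambda>t. f (- s + t))"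

definition dense_vector ::
  "'a::group_add measure \<Rightarrow> real \<Rightarrow> ('a \<Rightarrow> real) \<Rightarrow> complex set \<Rightarrow> 'a set \<Rightarrow> ('a \<Rightarrow> complex) \<Rightarrow> bool" where
  "dense_vector \<mu> p \<omega> \<Gamma> S f \<longleftrightarrow>
     f \<in> Lp_space \<mu> p \<omega> \<and>
     Lp_dense \<mu> p \<omega> {(\<lambda>t. c * left_translation s f t) | c s. c \<in> \<Gamma> \<and> s \<in> S}"

text \<open>
  The inclusion required in \<open>Lp_dense\<close> is automatic for the sets used in \<open>dense_vector\<close> when
  the weight is admissible.
\<close>
lemma scaled_translation_in_Lp_space:
  fixes \<mu> :: "'a::{topological_group_add, t2_space} measure"
  assumes haar: "left_haar_measure \<mu>" and w: "weight \<mu> p \<omega>" and p: "1 \<le> p"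
    and adm: "admissible \<mu> S \<omega>" and s: "s \<in> S" and f: "f \<in> Lp_space \<mu> p \<omega>"
  shows "(\<lambda>t. c * left_translation s f t) \<in> Lp_space \<mu> p \<omega>"
proof -
  have sets[measurable_cong]: "sets \<mu> = sets borel"
    and inv: "\<And>r A. A \<in> sets borel \<Longrightarrow> emeasure \<mu> ((\<lambda>t. r + t) ` A) = emeasure \<mu> A"
    using haar by (auto simp: left_haar_measure_def)
  have sp: "space \<mu> = UNIV" using sets_eq_imp_space_eq[OF sets] by simp
  have tr[measurable]: "(\<lambda>t. r + t) \<in> measurable \<mu> \<mu>" for r :: 'a
    by (subst measurable_cong_sets[OF sets sets])
       (intro borel_measurable_continuous_onI continuous_intros)
  have distr: "distr \<mu> \<mu> (\<lambda>t. r + t) = \<mu>" for r :: 'a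
  proof (rule measure_eqI)
    fix A assume "A \<in> sets (distr \<mu> \<mu> (\<lambda>t. r + t))"
    then have A: "A \<in> sets \<mu>" by simp
    have "(\<lambda>t. r + t) -` A = (\<lambda>t. - r + t) ` A"
      by (auto simp: image_iff algebra_simps intro!: bexI[where x="r + _"])
    then show "emeasure (distr \<mu> \<mu> (\<lambda>t. r + t)) A = emeasure \<mu> A"
      using A inv[of A "- r"] sets by (simp add: emeasure_distr sp)
  qed simp
  have fm[measurable]: "f \<in> borel_measurable \<mu>"
    and fi: "integrable \<mu> (\<lambda>t. cmod (f t) powr p * \<omega> t powr p)"
    using f by (auto simp: Lp_space_def)
  have wm[measurable]: "\<omega> \<in> borel_measurable \<mu>" and wpos: "\<And>t. 0 < \<omega> t"
    using w by (auto simp: weight_def)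
  let ?q = "\<lambda>t. ereal (\<omega> (s + t) / \<omega> t)"
  have fin: "esssup \<mu> ?q < \<infinity>" using adm s by (auto simp: admissible_def)
  then obtain B where B: "esssup \<mu> ?q \<le> ereal B"
    by (cases "esssup \<mu> ?q") auto
  have "AE t in \<mu>. ?q t \<le> esssup \<mu> ?q" by (rule esssup_AE)
  then have ae: "AE t in \<mu>. \<omega> (s + t) \<le> \<bar>B\<bar> * \<omega> t"
  proof eventually_elim
    case (elim t)
    with B have "\<omega> (s + t) / \<omega> t \<le> B" by (metis ereal_less_eq(3) order_trans)
    then have "\<omega> (s + t) \<le> B * \<omega> t" using wpos[of t] by (simp add: field_simps)
    also have "\<dots> \<le> \<bar>B\<bar> * \<omega> t" using wpos[of t] by (intro mult_right_mono) auto
    finally show ?case .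
  qed
  have "integrable \<mu> (\<lambda>t. cmod (f t) powr p * \<omega> (s + t) powr p)"
  proof (rule Bochner_Integration.integrable_bound)
    show "integrable \<mu> (\<lambda>t. \<bar>B\<bar> powr p * (cmod (f t) powr p * \<omega> t powr p))"
      using fi by (rule integrable_mult_right)
    show "AE t in \<mu>. norm (cmod (f t) powr p * \<omega> (s + t) powr p)
        \<le> norm (\<bar>B\<bar> powr p * (cmod (f t) powr p * \<omega> t powr p))"
      using ae
    proof eventually_elim
      case (elim t)
      have "\<omega> (s + t) powr p \<le> (\<bar>B\<bar> * \<omega> t) powr p"
        using elim wpos[of "s + t"] p by (intro powr_mono2) (auto simp: less_imp_le)
      also have "\<dots> = \<bar>B\<bar> powr p * \<omega> t powr p"
        using wpos[of t] by (simp add: powr_mult)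
      finally have "cmod (f t) powr p * \<omega> (s + t) powr p
          \<le> cmod (f t) powr p * (\<bar>B\<bar> powr p * \<omega> t powr p)"
        by (intro mult_left_mono) auto
      then show ?case by (simp add: abs_mult mult_ac)
    qed
  qed measurable
  then have "integrable (distr \<mu> \<mu> (\<lambda>t. - s + t)) (\<lambda>t. cmod (f t) powr p * \<omega> (s + t) powr p)"
    by (simp only: distr)
  then have "integrable \<mu> (\<lambda>t. cmod (f (- s + t)) powr p * \<omega> (s + (- s + t)) powr p)"
    by (rule integrable_distr[OF tr])
  then have "integrable \<mu> (\<lambda>t. cmod (f (- s + t)) powr p * \<omega> t powr p)"
    by (simp add: add.assoc[symmetric])
  then have "integrable \<mu> (\<lambda>t. cmod c powr p * (cmod (f (- s + t)) powr p * \<omega> t powr p))"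
    by (rule integrable_mult_right)
  moreover have "(\<lambda>t. c * f (- s + t)) \<in> borel_measurable \<mu>" by measurable
  ultimately show ?thesis
    by (simp add: Lp_space_def left_translation_def norm_mult powr_mult mult.assoc)
qed

end

theory Submission
  imports Defs
begin

text \<open>
  Convergence in $L^p(G,\omega)$ implies convergence in measure, and a left translation does not
  change the distribution of a function. Hence if \<open>c\<^sub>n T\<^bsub>s\<^sub>n\<^esub> f\<close> converges to the constant \<open>1\<close>, which
  belongs to $L^p(G,\omega)$ by compactness, then \<open>c\<^sub>n f\<close> converges to \<open>1\<close> in measure, so \<open>f\<close> is
  constant almost everywhere. Limits of scaled translates of a constant are constant, but the
  indicator function of a small open set is not.
\<close>

text \<open>The norm of the difference is at most twice the larger norm, and the \<open>p\<close>-th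
  power of a maximum is at most the sum of the \<open>p\<close>-th powers. This crude constant is
  enough for integrability.\<close>

lemma powr_norm_diff_le:
  fixes a b :: "'b::real_normed_vector"
  assumes "0 \<le> p"
  shows "norm (a - b) powr p \<le> 2 powr p * (norm a powr p + norm b powr p)"
proof -
  have "norm (a - b) powr p \<le> (2 * max (norm a) (norm b)) powr p"
    using norm_triangle_ineq4[of a b] assms by (intro powr_mono2) auto
  also have "\<dots> = 2 powr p * max (norm a) (norm b) powr p"
    by (simp add: powr_mult)
  also have "\<dots> \<le> 2 powr p * (norm a powr p + norm b powr p)"
    by (intro mult_left_mono) (auto simp: max_def)
  finally show ?thesis .
qed

text \<open>Guarantees that a small \<open>Lp_norm\<close> of a difference is informative: the
  Bochner integral of a non-integrable function is 0 by default.\<close>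

lemma Lp_space_diff_integrable:
  assumes p: "0 \<le> p" and [measurable]: "\<omega> \<in> borel_measurable \<mu>"
    and g: "g \<in> Lp_space \<mu> p \<omega>" and h: "h \<in> Lp_space \<mu> p \<omega>"
  shows "integrable \<mu> (\<lambda>t. cmod (g t - h t) powr p * \<omega> t powr p)"
proof (rule Bochner_Integration.integrable_bound)
  have [measurable]: "g \<in> borel_measurable \<mu>" "h \<in> borel_measurable \<mu>"
    using g h by (auto simp: Lp_space_def)
  show "(\<lambda>t. cmod (g t - h t) powr p * \<omega> t powr p) \<in> borel_measurable \<mu>"
    by measurable
  show "integrable \<mu> (\<lambda>t. 2 powr p *
      (cmod (g t) powr p * \<omega> t powr p + cmod (h t) powr p * \<omega> t powr p))"
    using g h by (auto simp: Lp_space_def)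
  show "AE t in \<mu>. norm (cmod (g t - h t) powr p * \<omega> t powr p) \<le> norm (2 powr p *
      (cmod (g t) powr p * \<omega> t powr p + cmod (h t) powr p * \<omega> t powr p))"
  proof (rule AE_I2)
    fix t
    have "cmod (g t - h t) powr p * \<omega> t powr p
        \<le> 2 powr p * (cmod (g t) powr p + cmod (h t) powr p) * \<omega> t powr p"
      by (intro mult_right_mono powr_norm_diff_le p) auto
    then show "norm (cmod (g t - h t) powr p * \<omega> t powr p) \<le> norm (2 powr p *
        (cmod (g t) powr p * \<omega> t powr p + cmod (h t) powr p * \<omega> t powr p))"
      by (simp add: abs_mult algebra_simps)
  qed
qed

text \<open>The \<open>p\<close>-th powers of the distances are integrals of nonnegative functions,
  so norm convergence is L1 convergence of these functions to 0, and a subsequence converges almost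
  everywhere.\<close>

lemma Lp_dense_AE_approx:
  assumes p: "1 \<le> p" and [measurable]: "\<omega> \<in> borel_measurable \<mu>" and pos: "\<And>t. 0 < \<omega> t"
    and A: "Lp_dense \<mu> p \<omega> A" and g: "g \<in> Lp_space \<mu> p \<omega>"
  obtains h where "\<And>n::nat. h n \<in> A" and "AE t in \<mu>. (\<lambda>n. h n t) \<longlonglongrightarrow> g t"
proof -
  have "\<forall>n::nat. \<exists>h\<in>A. Lp_norm \<mu> p \<omega> (\<lambda>t. g t - h t) < inverse (real (Suc n))"
    using A g by (simp add: Lp_dense_def)
  then obtain h where hA: "\<And>n. h n \<in> A"
    and h: "\<And>n. Lp_norm \<mu> p \<omega> (\<lambda>t. g t - h n t) < inverse (real (Suc n))"
    by metis
  define u where "u n t = cmod (g t - h n t) powr p * \<omega> t powr p" for n t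
  have int: "integrable \<mu> (u n)" for n
    unfolding u_def using hA A g p by (intro Lp_space_diff_integrable) (auto simp: Lp_dense_def)
  have nn: "0 \<le> integral\<^sup>L \<mu> (u n)" for n
    by (rule integral_nonneg_AE) (simp add: u_def)
  have "(\<lambda>n. Lp_norm \<mu> p \<omega> (\<lambda>t. g t - h n t)) \<longlonglongrightarrow> 0"
    by (rule tendsto_sandwich[OF _ _ tendsto_const LIMSEQ_inverse_real_of_nat])
       (use less_imp_le[OF h] in \<open>auto simp: Lp_norm_def\<close>)
  then have "(\<lambda>n. integral\<^sup>L \<mu> (u n) powr (1 / p)) \<longlonglongrightarrow> 0"
    by (simp add: Lp_norm_def u_def[abs_def])
  then have "(\<lambda>n. (integral\<^sup>L \<mu> (u n) powr (1 / p)) powr p) \<longlonglongrightarrow> 0 powr p"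
    using p by (intro tendsto_powr2) auto
  then have "(\<lambda>n. integral\<^sup>L \<mu> (u n)) \<longlonglongrightarrow> 0"
    using p nn by (simp add: powr_powr)
  then have "(\<lambda>n. \<integral>t. norm (u n t) \<partial>\<mu>) \<longlonglongrightarrow> 0"
    by (simp add: u_def[abs_def] abs_mult)
  then obtain r :: "nat \<Rightarrow> nat" where r: "AE t in \<mu>. (\<lambda>n. u (r n) t) \<longlonglongrightarrow> 0"
    using tendsto_L1_AE_subseq[of \<mu> u, OF int] by blast
  have "AE t in \<mu>. (\<lambda>n. h (r n) t) \<longlonglongrightarrow> g t"
    using r
  proof eventually_elim
    case (elim t)
    \<comment> \<open>Positivity of the weight lets the pointwise distance be recovered from
      \<open>u n t\<close>.\<close>
    have root: "u n t powr (1 / p) / \<omega> t = cmod (g t - h n t)" for n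
      using p pos[of t] by (simp add: u_def powr_mult powr_powr)
    have "(\<lambda>n. u (r n) t powr (1 / p)) \<longlonglongrightarrow> 0 powr (1 / p)"
      using elim p by (intro tendsto_powr2) (auto simp: u_def)
    then have "(\<lambda>n. u (r n) t powr (1 / p) / \<omega> t) \<longlonglongrightarrow> 0"
      by (intro tendsto_divide_zero) simp
    then have "(\<lambda>n. g t - h (r n) t) \<longlonglongrightarrow> 0"
      unfolding root by (rule tendsto_norm_zero_cancel)
    then have "(\<lambda>n. g t - (g t - h (r n) t)) \<longlonglongrightarrow> g t - 0"
      by (intro tendsto_diff tendsto_const)
    then show ?case by simp
  qed
  then show ?thesis using hA that[of "\<lambda>n. h (r n)"] by blast
qed

text \<open>Invariance under images becomes invariance of the push-forward, because the preimage
  under translation by \<open>s\<close> is the image under translation by \<open>- s\<close>. In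
  this form it applies to integrals and to almost-everywhere statements.\<close>

lemma
  fixes \<mu> :: "'a::{topological_group_add, t2_space} measure"
  assumes haar: "left_haar_measure \<mu>"
  shows left_haar_measure_translation_measurable: "(\<lambda>t. s + t) \<in> measurable \<mu> \<mu>"
    and left_haar_measure_distr: "distr \<mu> \<mu> (\<lambda>t. s + t) = \<mu>"
proof -
  have sets: "sets \<mu> = sets borel"
    and inv: "\<And>r A. A \<in> sets borel \<Longrightarrow> emeasure \<mu> ((\<lambda>t. r + t) ` A) = emeasure \<mu> A"
    using haar by (auto simp: left_haar_measure_def)
  have sp: "space \<mu> = UNIV" using sets_eq_imp_space_eq[OF sets] by simp
  show tr: "(\<lambda>t. s + t) \<in> measurable \<mu> \<mu>"
    by (subst measurable_cong_sets[OF sets sets])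
       (intro borel_measurable_continuous_onI continuous_intros)
  show "distr \<mu> \<mu> (\<lambda>t. s + t) = \<mu>"
  proof (rule measure_eqI)
    fix A assume "A \<in> sets (distr \<mu> \<mu> (\<lambda>t. s + t))"
    then have A: "A \<in> sets \<mu>" by simp
    have "(\<lambda>t. s + t) -` A = (\<lambda>t. - s + t) ` A"
      by (auto simp: image_iff algebra_simps intro!: bexI[where x="s + _"])
    then show "emeasure (distr \<mu> \<mu> (\<lambda>t. s + t)) A = emeasure \<mu> A"
      using A inv[of A "- s"] sets tr by (simp add: emeasure_distr sp)
  qed simp
qed

text \<open>By compactness finitely many translates of \<open>U\<close> cover the group; if
  \<open>U\<close> were null, so would be the whole group.\<close>

lemma left_haar_measure_open_pos:
  fixes \<mu> :: "'a::{topological_group_add, t2_space} measure"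
  assumes haar: "left_haar_measure \<mu>" and comp: "compact (UNIV :: 'a set)"
    and U: "open U" "U \<noteq> {}"
  shows "emeasure \<mu> U \<noteq> 0"
proof
  assume null: "emeasure \<mu> U = 0"
  have sets: "sets \<mu> = sets borel"
    and inv: "\<And>r A. A \<in> sets borel \<Longrightarrow> emeasure \<mu> ((\<lambda>t. r + t) ` A) = emeasure \<mu> A"
    and nz: "emeasure \<mu> UNIV \<noteq> 0"
    using haar by (auto simp: left_haar_measure_def)
  have img: "(\<lambda>t. s + t) ` U = (\<lambda>t. - s + t) -` U" for s
    by (auto simp: image_iff algebra_simps intro!: bexI[where x="- s + _"])
  have op: "open ((\<lambda>t. s + t) ` U)" for s
    unfolding img using U(1) by (intro open_vimage continuous_intros)
  obtain u where u: "u \<in> U" using U(2) by auto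
  have "x \<in> (\<lambda>t. (x - u) + t) ` U" for x
    using u by (auto simp: image_iff intro!: bexI[where x=u])
  then have "UNIV \<subseteq> (\<Union>s\<in>UNIV. (\<lambda>t. s + t) ` U)" by blast
  with comp op obtain F where F: "finite F" "UNIV \<subseteq> (\<Union>s\<in>F. (\<lambda>t. s + t) ` U)"
    by (rule compactE_image) auto
  have "(\<Union>s\<in>F. (\<lambda>t. s + t) ` U) \<in> null_sets \<mu>"
    using F(1) op U(1) sets inv null
    by (intro null_sets_UN' countable_finite) (auto simp: null_sets_def)
  with F(2) nz show False by (simp add: top.extremum_unique null_sets_def)
qed

text \<open>
  Since the translations depend on \<open>n\<close>, pointwise convergence carries over to \<open>c\<^sub>n f\<close> only
  through the translation-invariant integrals of \<open>min 1 \<bar>1 - c\<^sub>n f\<bar>\<close>.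
\<close>
lemma AE_const_if_scaled_translates_tendsto_1:
  fixes \<mu> :: "'a::{topological_group_add, t2_space} measure" and f :: "'a \<Rightarrow> complex"
  assumes haar: "left_haar_measure \<mu>" and fin: "finite_measure \<mu>"
    and [measurable]: "f \<in> borel_measurable \<mu>"
    and lim: "AE t in \<mu>. (\<lambda>n. c n * left_translation (s n) f t) \<longlonglongrightarrow> 1"
  shows "\<exists>k. AE t in \<mu>. f t = k"
proof -
  interpret finite_measure \<mu> by (rule fin)
  note [measurable] = left_haar_measure_translation_measurable[OF haar]
  \<comment> \<open>Truncation at 1 makes \<open>d n\<close> integrable over a finite measure and
    dominated by 1, whatever the scalars \<open>c n\<close>.\<close>
  define d where "d n t = min 1 (cmod (1 - c n * f t))" for n t
  have dm[measurable]: "d n \<in> borel_measurable \<mu>" for n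
    unfolding d_def by measurable
  have int: "integrable \<mu> (d n)" for n
    by (rule integrable_const_bound[of _ 1]) (auto simp: d_def)
  have "(\<lambda>n. \<integral>t. d n (- s n + t) \<partial>\<mu>) \<longlonglongrightarrow> (\<integral>t. 0 \<partial>\<mu>)"
  proof (rule integral_dominated_convergence)
    show "AE t in \<mu>. (\<lambda>n. d n (- s n + t)) \<longlonglongrightarrow> 0"
      using lim
    proof eventually_elim
      case (elim t)
      then have "(\<lambda>n. min 1 (cmod (1 - c n * f (- s n + t)))) \<longlonglongrightarrow> min 1 (cmod (1 - 1))"
        unfolding left_translation_def by (intro tendsto_intros)
      then show ?case by (simp add: d_def)
    qed
    show "integrable \<mu> (\<lambda>t. 1::real)" by simp
  qed (auto simp: d_def)
  moreover have "(\<integral>t. d n (- s n + t) \<partial>\<mu>) = integral\<^sup>L \<mu> (d n)" for n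
    using integral_distr[of "\<lambda>t. - s n + t" \<mu> \<mu> "d n"]
    by (simp add: left_haar_measure_distr[OF haar])
  moreover have "norm (d n t) = d n t" for n t by (simp add: d_def)
  ultimately have "(\<lambda>n. \<integral>t. norm (d n t) \<partial>\<mu>) \<longlonglongrightarrow> 0"
    by simp
  then obtain r :: "nat \<Rightarrow> nat" where r: "AE t in \<mu>. (\<lambda>n. d (r n) t) \<longlonglongrightarrow> 0"
    using tendsto_L1_AE_subseq[of \<mu> d, OF int] by blast
  \<comment> \<open>The candidate constant is written without \<open>t\<close>. At each good point
    the proof shows that \<open>c (r n)\<close> converges to \<open>1 / f t\<close>, so
    \<open>lim\<close> is there a true limit and the same for all such points.\<close>
  have "AE t in \<mu>. f t = inverse (lim (\<lambda>n. c (r n)))"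
    using r
  proof eventually_elim
    case (elim t)
    \<comment> \<open>Once \<open>d (r n) t\<close> is below 1, the truncation is inactive.\<close>
    have "eventually (\<lambda>n. d (r n) t < 1) sequentially"
      using elim by (rule order_tendstoD) simp
    then have "eventually (\<lambda>n. d (r n) t = cmod (1 - c (r n) * f t)) sequentially"
      by eventually_elim (auto simp: d_def min_def split: if_splits)
    with elim have "(\<lambda>n. cmod (1 - c (r n) * f t)) \<longlonglongrightarrow> 0"
      by (rule Lim_transform_eventually)
    then have "(\<lambda>n. 1 - c (r n) * f t) \<longlonglongrightarrow> 0"
      by (rule tendsto_norm_zero_cancel)
    then have "(\<lambda>n. 1 - (1 - c (r n) * f t)) \<longlonglongrightarrow> 1 - 0"
      by (intro tendsto_diff tendsto_const)
    then have cf: "(\<lambda>n. c (r n) * f t) \<longlonglongrightarrow> 1" by simp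
    \<comment> \<open>If \<open>f t\<close> were 0, the products would be constantly 0 and could not
      tend to 1.\<close>
    then have nz: "f t \<noteq> 0" by (auto simp: LIMSEQ_const_iff)
    have "(\<lambda>n. c (r n) * f t / f t) \<longlonglongrightarrow> 1 / f t"
      using cf nz by (intro tendsto_divide tendsto_const)
    then have "(\<lambda>n. c (r n)) \<longlonglongrightarrow> 1 / f t" using nz by simp
    then have "lim (\<lambda>n. c (r n)) = 1 / f t" by (rule limI)
    then show ?case by simp
  qed
  then show ?thesis by blast
qed

theorem proposition2p4:
  fixes \<mu> :: "'a::{topological_group_add, t2_space} measure"
    and p :: real and \<omega> :: "'a \<Rightarrow> real" and S :: "'a set" and \<Gamma> :: "complex set"
  assumes "compact (UNIV :: 'a set)"
    and "(UNIV :: 'a set) \<noteq> {0}"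
    and "left_haar_measure \<mu>"
    and "1 \<le> p"
    and "weight \<mu> p \<omega>"
    and "admissible \<mu> S \<omega>"
  shows "\<not> (\<exists>f. dense_vector \<mu> p \<omega> \<Gamma> S f)"
proof
  assume "\<exists>f. dense_vector \<mu> p \<omega> \<Gamma> S f"
  then obtain f where f: "f \<in> Lp_space \<mu> p \<omega>"
    and dense: "Lp_dense \<mu> p \<omega> {(\<lambda>t. c * left_translation s f t) | c s. c \<in> \<Gamma> \<and> s \<in> S}"
    by (auto simp: dense_vector_def)
  note comp = assms(1) and haar = assms(3) and p = assms(4)
  have sets[measurable_cong]: "sets \<mu> = sets borel"
    using haar by (simp add: left_haar_measure_def)
  have "\<forall>K::'a set. compact K \<longrightarrow> emeasure \<mu> K < \<infinity>"
    using haar unfolding left_haar_measure_def by (elim conjE)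
  with comp have fin: "emeasure \<mu> UNIV < \<infinity>" by blast
  have sp: "space \<mu> = UNIV" using sets_eq_imp_space_eq[OF sets] by simp
  have finite: "finite_measure \<mu>"
    using fin by (intro finite_measureI) (simp add: sp)
  \<comment> \<open>The group itself is compact, so local integrability of the weight is
    integrability over the whole group.\<close>
  have wm[measurable]: "\<omega> \<in> borel_measurable \<mu>" and pos: "\<And>t. 0 < \<omega> t"
    and "(\<integral>\<^sup>+t\<in>UNIV. ennreal (\<omega> t powr p) \<partial>\<mu>) < \<infinity>"
    using assms(5) comp unfolding weight_def by blast+
  then have wint: "integrable \<mu> (\<lambda>t. \<omega> t powr p)"
    by (intro integrableI_bounded) auto
  have fm: "f \<in> borel_measurable \<mu>" using f by (simp add: Lp_space_def)
  have approx: "\<exists>c s. AE t in \<mu>. (\<lambda>n::nat. c n * left_translation (s n) f t) \<longlonglongrightarrow> g t"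
    if g: "g \<in> Lp_space \<mu> p \<omega>" for g
  proof -
    obtain h where h: "\<And>n::nat. h n \<in> {(\<lambda>t. c * left_translation s f t) | c s. c \<in> \<Gamma> \<and> s \<in> S}"
      and lim: "AE t in \<mu>. (\<lambda>n. h n t) \<longlonglongrightarrow> g t"
      using Lp_dense_AE_approx[OF p wm pos dense g] by blast
    have "\<forall>n. \<exists>c s. h n = (\<lambda>t. c * left_translation s f t)" using h by blast
    then obtain c s where "\<And>n. h n = (\<lambda>t. c n * left_translation (s n) f t)" by metis
    with lim show ?thesis by auto
  qed
  have "(\<lambda>_. 1) \<in> Lp_space \<mu> p \<omega>" using wint by (simp add: Lp_space_def)
  from approx[OF this] obtain k where k: "AE t in \<mu>. f t = k"
    using AE_const_if_scaled_translates_tendsto_1[OF haar finite fm] by blast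

  \<comment> \<open>Separating two points yields nonempty open sets, hence sets of positive measure,
    on which the indicator of \<open>U\<close> is 1 and 0 respectively.\<close>
  obtain a :: 'a where "a \<noteq> 0" using assms(2) by blast
  then obtain U V where UV: "open U" "open V" "0 \<in> U" "a \<in> V" "U \<inter> V = {}"
    by (metis hausdorff)
  have [measurable]: "U \<in> sets \<mu>" "V \<in> sets \<mu>" using UV sets by auto
  have U_pos: "emeasure \<mu> U \<noteq> 0" and V_pos: "emeasure \<mu> V \<noteq> 0"
    using left_haar_measure_open_pos[OF haar comp] UV by blast+
  have "(\<lambda>t. indicator U t :: complex) \<in> Lp_space \<mu> p \<omega>"
  proof -
    have "(\<lambda>t. cmod (indicator U t) powr p * \<omega> t powr p) = (\<lambda>t. indicator U t * \<omega> t powr p)"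
      by (auto simp: indicator_def)
    then show ?thesis
      using integrable_real_mult_indicator[OF \<open>U \<in> sets \<mu>\<close> wint]
      by (simp add: Lp_space_def mult.commute)
  qed
  from approx[OF this] obtain c s where
    lim: "AE t in \<mu>. (\<lambda>n::nat. c n * left_translation (s n) f t) \<longlonglongrightarrow> indicator U t"
    by blast
  have "AE t in \<mu>. left_translation (s n) f t = k" for n
  proof -
    have "AE t in distr \<mu> \<mu> (\<lambda>t. - s n + t). f t = k"
      using k by (simp only: left_haar_measure_distr[OF haar])
    then show ?thesis
      using AE_distrD[OF left_haar_measure_translation_measurable[OF haar]]
      unfolding left_translation_def by blast
  qed
  \<comment> \<open>The exceptional set depends on \<open>n\<close>, but a countable union of null
    sets is null.\<close>
  then have "AE t in \<mu>. \<forall>n. left_translation (s n) f t = k"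
    by (simp add: AE_all_countable)
  with lim have ae: "AE t in \<mu>. (\<lambda>n. c n * k) \<longlonglongrightarrow> indicator U t"
    by eventually_elim simp
  \<comment> \<open>A set of positive measure cannot lie inside the exceptional null set of
    \<open>ae\<close>.\<close>
  have ex: "\<exists>t\<in>W. (\<lambda>n. c n * k) \<longlonglongrightarrow> indicator U t"
    if W: "W \<in> sets \<mu>" "emeasure \<mu> W \<noteq> 0" for W
  proof (rule ccontr)
    assume no: "\<not> ?thesis"
    from ae have "AE t in \<mu>. t \<notin> W"
      by eventually_elim (use no in blast)
    then have "emeasure \<mu> W = 0"
      using W(1) by (simp add: AE_iff_measurable[OF W(1)] sp)
    with W(2) show False by simp
  qed
  \<comment> \<open>The sequence \<open>c n * k\<close> does not involve the point, so its limits at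
    \<open>x\<close> and \<open>y\<close> agree, which forces 1 = 0.\<close>
  obtain x y where "x \<in> U" "y \<in> V" "(\<lambda>n. c n * k) \<longlonglongrightarrow> indicator U x"
    "(\<lambda>n. c n * k) \<longlonglongrightarrow> indicator U y"
    using ex[OF \<open>U \<in> sets \<mu>\<close> U_pos] ex[OF \<open>V \<in> sets \<mu>\<close> V_pos] by blast
  then have "(indicator U x :: complex) = indicator U y"
    by (metis LIMSEQ_unique)
  then show False using \<open>x \<in> U\<close> \<open>y \<in> V\<close> UV(5) by (auto simp: indicator_def)
qed

end
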